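(* Let $q\equiv 3\pmod 4$ be a prime power. A map $\psi:\mathbb{F}_q^4\to\mathbb{F}_q^4$ satisfies, for all $\mathbf{r}_1,\mathbf{r}_2\in\mathbb{F}_q^4$, $$(\mathbf{r}_1-\mathbf{r}_2,\mathbf{r}_1-\mathbf{r}_2)=0,\ \mathbf{r}_1\neq\mathbf{r}_2\ \Longrightarrow\ \big(\psi(\mathbf{r}_1)-\psi(\mathbf{r}_2),\psi(\mathbf{r}_1)-\psi(\mathbf{r}_2)\big)=0,\ \psi(\mathbf{r}_1)\neq\psi(\mathbf{r}_2),$$ if and only if it is of the form $\psi(\mathbf{r})=\alpha L\mathbf{r}^\tau+\mathbf{r}_0$ for all $\mathbf{r}$, or $\psi(\mathbf{r})=\alpha K\mathbf{r}^\tau+\mathbf{r}_0$ for all $\mathbf{r}$, where $0\neq\alpha\in\mathbb{F}_q$ and $\mathbf{r}_0\in\mathbb{F}_q^4$ are fixed, $\tau$ is an automorphism of $\mathbb{F}_q$ applied coordinate-wise, and $L$ and $K$ are a Lorentz and an anti-Lorentz matrix respectively.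
   Context: For $\mathbf{r}_k=(x_k,y_k,z_k,t_k)^\top\in\mathbb{F}_q^4$ put $(\mathbf{r}_1,\mathbf{r}_2)=-x_1x_2-y_1y_2-z_1z_2+t_1t_2$. A $4\times4$ matrix $L$ over $\mathbb{F}_q$ is Lorentz if $(L\mathbf{r}_1,L\mathbf{r}_2)=(\mathbf{r}_1,\mathbf{r}_2)$ for all $\mathbf{r}_1,\mathbf{r}_2\in\mathbb{F}_q^4$, and anti-Lorentz if $(K\mathbf{r}_1,K\mathbf{r}_2)=-(\mathbf{r}_1,\mathbf{r}_2)$ for all $\mathbf{r}_1,\mathbf{r}_2$. *)

theory Defs
  imports "HOL-Analysis.Analysis"
begin

text \<open>Vectors r = (x,y,z,t) in F_q^4 are modelled as 'a ^ 4; the coordinates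
  x,y,z,t are the components at indices 1,2,3,4 of the type 4 (these four
  indices are pairwise distinct; 4 coincides with 0 in the numeral type 4).\<close>

definition mink :: "'a::comm_ring_1 ^ 4 \<Rightarrow> 'a ^ 4 \<Rightarrow> 'a" where
  "mink r1 r2 = - (r1$1 * r2$1) - r1$2 * r2$2 - r1$3 * r2$3 + r1$4 * r2$4"

definition lorentz :: "'a::comm_ring_1 ^ 4 ^ 4 \<Rightarrow> bool" where
  "lorentz L \<longleftrightarrow> (\<forall>r1 r2. mink (L *v r1) (L *v r2) = mink r1 r2)"

definition anti_lorentz :: "'a::comm_ring_1 ^ 4 ^ 4 \<Rightarrow> bool" where
  "anti_lorentz K \<longleftrightarrow> (\<forall>r1 r2. mink (K *v r1) (K *v r2) = - mink r1 r2)"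

definition field_aut :: "('a::field \<Rightarrow> 'a) \<Rightarrow> bool" where
  "field_aut \<tau> \<longleftrightarrow> bij \<tau> \<and> (\<forall>x y. \<tau> (x + y) = \<tau> x + \<tau> y) \<and>
     (\<forall>x y. \<tau> (x * y) = \<tau> x * \<tau> y) \<and> \<tau> 1 = 1"

definition vmap :: "('a \<Rightarrow> 'a) \<Rightarrow> 'a ^ 'n \<Rightarrow> 'a ^ 'n" where
  "vmap \<tau> r = (\<chi> i. \<tau> (r $ i))"

end

theory Submission
  imports Defs
begin

text \<open>Since -1 is a nonsquare, the form has Witt index one, so the cliques of the graph "the
  difference is null" lie on null lines. An endomorphism of minimal image shows that every
  endomorphism is injective: otherwise its image would be a clique, and a fibre would meet each
  null line exactly once, which a double count excludes. An injective endomorphism is an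
  automorphism, since the space is finite. It preserves null lines and the tangent hyperplanes
  a + u^perp with u null, hence parallelism of null lines; therefore parallelograms with null sides
  go to parallelograms, which gives additivity. Linear relations between null vectors force the
  scaling functions of all null lines to be one and the same field automorphism. Finally a
  quadratic form vanishing on all null vectors is a multiple of the given one, and every element of
  the field is plus or minus a square.\<close>

section \<open>Finite fields of order 3 modulo 4\<close>

text \<open>Multiplication by \<open>x\<close> permutes the nonzero elements, hence fixes their
  product.\<close>

lemma finite_field_power_card_minus_one:
  fixes x :: "'a::{finite,field}"
  assumes "x \<noteq> 0"
  shows "x ^ (CARD('a) - 1) = 1"
proof -
  let ?N = "UNIV - {0::'a}"
  have "bij_betw ((*) x) ?N ?N"
    using assms by (intro bij_betwI[where g = "\<lambda>y. y / x"]) auto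
  then have "\<Prod>?N = (\<Prod>y\<in>?N. x * y)"
    by (rule prod.reindex_bij_betw[symmetric])
  also have "\<dots> = x ^ (CARD('a) - 1) * \<Prod>?N"
    by (simp add: prod.distrib card_Diff_singleton)
  finally show ?thesis
    by (simp add: prod_zero_iff)
qed

text \<open>Translation by 1 permutes the field, hence fixes the sum of all elements.\<close>

lemma of_nat_card_eq_0: "of_nat CARD('a) = (0::'a::{finite,field})"
proof -
  have "bij (\<lambda>x::'a. x + 1)"
    by (rule bijI) (auto simp: inj_on_def surj_def intro: exI[of _ "_ - 1"])
  from sum.reindex_bij_betw[OF this, of "\<lambda>x. x"] show ?thesis
    by (simp add: sum.distrib)
qed

section \<open>The bilinear form and its reflections\<close>

lemma mink_add_left: "mink (x + y) z = mink x z + mink y z"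
  and mink_add_right: "mink z (x + y) = mink z x + mink z y"
  and mink_diff_left: "mink (x - y) z = mink x z - mink y z"
  and mink_diff_right: "mink z (x - y) = mink z x - mink z y"
  and mink_minus_left: "mink (- x) z = - mink x z"
  and mink_minus_right: "mink z (- x) = - mink z x"
  and mink_scale_left: "mink (c *s x) z = c * mink x z"
  and mink_scale_right: "mink z (c *s x) = c * mink z x"
  and mink_zero_left: "mink 0 z = 0"
  and mink_zero_right: "mink z 0 = 0"
  by (simp_all add: mink_def algebra_simps)

lemmas mink_linear = mink_add_left mink_add_right mink_diff_left mink_diff_right
  mink_minus_left mink_minus_right mink_scale_left mink_scale_right mink_zero_left mink_zero_right

lemma mink_commute: "mink x y = mink y x"
  by (simp add: mink_def algebra_simps)

lemma mink_nondegenerate: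
  assumes "\<And>y. mink x y = 0"
  shows "x = 0"
proof -
  have "x $ i = 0" for i
    using assms[of "axis i 1"] exhaust_4[of i] by (auto simp: mink_def axis_def)
  then show ?thesis by (simp add: vec_eq_iff)
qed

definition vec4 :: "'a \<Rightarrow> 'a \<Rightarrow> 'a \<Rightarrow> 'a \<Rightarrow> 'a::zero ^ 4" where
  "vec4 x y z t = (\<chi> i. if i = 1 then x else if i = 2 then y else if i = 3 then z else t)"

lemma vec4_nth [simp]:
  "vec4 x y z t $ 1 = x" "vec4 x y z t $ 2 = y" "vec4 x y z t $ 3 = z" "vec4 x y z t $ 4 = t"
  by (simp_all add: vec4_def)

lemma vec4_eqI:
  assumes "x $ 1 = y $ 1" "x $ 2 = y $ 2" "x $ 3 = y $ 3" "x $ 4 = y $ 4"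
  shows "x = (y :: 'a ^ 4)"
  using assms by (simp add: vec_eq_iff forall_4)

text \<open>Reflection in the hyperplane orthogonal to \<open>w\<close>: the term quadratic in
  \<open>w\<close> cancels the two cross terms.\<close>

lemma mink_reflection:
  fixes w :: "'a::field ^ 4"
  assumes w: "mink w w \<noteq> 0"
  shows "mink (x - (2 * mink x w / mink w w) *s w) (y - (2 * mink y w / mink w w) *s w) = mink x y"
proof -
  define c e where "c = 2 * mink x w / mink w w" and "e = 2 * mink y w / mink w w"
  have "mink (x - c *s w) (y - e *s w) = mink x y - e * mink x w - c * mink y w + c * (e * mink w w)"
    unfolding mink_linear mink_commute[of w y] by (simp add: algebra_simps)
  moreover have "e * mink w w = 2 * mink y w" "e * mink x w = c * mink y w"
    using w by (simp_all add: c_def e_def)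
  ultimately show ?thesis by (simp add: c_def e_def algebra_simps)
qed

locale finite_field_3_mod_4 =
  fixes ty :: "'a::{finite,field} itself"
  assumes card_mod_4: "CARD('a) mod 4 = 3"
begin

lemma two_neq_0: "(2::'a) \<noteq> 0"
proof
  assume two: "(2::'a) = 0"
  have "CARD('a) = 2 * (CARD('a) div 2) + 1"
    using card_mod_4 by presburger
  then have "(of_nat CARD('a) :: 'a) = 2 * of_nat (CARD('a) div 2) + 1"
    by (metis of_nat_1 of_nat_add of_nat_mult of_nat_numeral)
  then show False
    by (simp add: of_nat_card_eq_0 two)
qed

lemma four_neq_0: "(4::'a) \<noteq> 0"
  using two_neq_0 by (metis mult_2_right no_zero_divisors numeral_Bit0 one_add_one)

text \<open>With q - 1 = 2m and m odd, a root of -1 would give 1 = \<open>x ^ (2 * m)\<close> =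
  (-1)^m = -1.\<close>

lemma square_neq_minus_1: "x * x \<noteq> (- 1 :: 'a)"
proof
  assume *: "x * x = - 1"
  define m where "m = CARD('a) div 2"
  have m: "odd m" "CARD('a) - 1 = 2 * m"
    using card_mod_4 unfolding m_def by presburger+
  have "x \<noteq> 0" using * by auto
  then have "1 = x ^ (2 * m)"
    using finite_field_power_card_minus_one[of x] m by simp
  also have "\<dots> = - 1"
    using * m(1) by (simp add: power_mult power2_eq_square)
  finally show False
    using two_neq_0 by (simp add: eq_neg_iff_add_eq_0)
qed

lemma sum_squares_eq_0D:
  assumes "x * x + y * y = (0::'a)"
  shows "x = 0" "y = 0"
proof -
  have "x = 0 \<and> y = 0"
  proof (cases "y = 0")
    case False
    with assms have "(x / y) * (x / y) = - 1"
      by (simp add: field_simps eq_neg_iff_add_eq_0)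
    then show ?thesis using square_neq_minus_1 by blast
  qed (use assms in simp)
  then show "x = 0" "y = 0" by auto
qed

text \<open>For nonzero \<open>c\<close> the power \<open>c ^ m\<close> is 1 or -1; as m is odd,
  \<open>c\<close> or \<open>- c\<close> has m-th power 1, and such an element is the square of its
  power with exponent (m + 1) / 2.\<close>

lemma square_or_minus_square: "\<exists>s. c = s * s \<or> c = - (s * s :: 'a)"
proof (cases "c = 0")
  case False
  define m where "m = CARD('a) div 2"
  have m: "odd m" "CARD('a) - 1 = 2 * m"
    using card_mod_4 unfolding m_def by presburger+
  obtain k where k: "m + 1 = 2 * k" using m(1) by (metis even_plus_one_iff evenE)
  have sq: "x = x ^ k * x ^ k" if "x ^ m = 1" for x :: 'a
  proof -
    have "x ^ k * x ^ k = x ^ (m + 1)" unfolding k by (simp add: mult_2 power_add)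
    with that show ?thesis by simp
  qed
  have "(c ^ m)\<^sup>2 = 1"
    using finite_field_power_card_minus_one[OF False] m by (metis mult.commute power_mult)
  then consider "c ^ m = 1" | "(- c) ^ m = 1"
    using m(1) by (auto simp: power2_eq_1_iff)
  then show ?thesis
    by cases (metis sq, metis sq minus_minus)
qed simp

text \<open>Otherwise 1 + s^2 is a square for all s, so by induction every multiple of 1 is a square,
  including -1.\<close>

lemma sum_two_squares_minus_1:
  obtains a b :: 'a where "a \<noteq> 0" "b \<noteq> 0" "a * a + b * b = - 1"
proof -
  have "\<exists>a b :: 'a. a * a + b * b = - 1"
  proof (rule ccontr)
    assume neg: "\<not> ?thesis"
    have "\<exists>s::'a. of_nat n = s * s" for n
    proof (induction n)
      case 0 show ?case by (rule exI[of _ 0]) simp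
    next
      case (Suc n)
      then obtain s :: 'a where s: "of_nat n = s * s" by blast
      \<comment> \<open>By \<open>neg\<close>, the element \<open>- 1 - s * s\<close> is not a
        square, so it is minus a square.\<close>
      obtain t :: 'a where "- 1 - s * s = t * t \<or> - 1 - s * s = - (t * t)"
        using square_or_minus_square by blast
      with neg have "1 + s * s = t * t"
        by (metis add.commute add_uminus_conv_diff diff_add_cancel minus_add_distrib minus_minus)
      with s show ?case by auto
    qed
    then obtain s :: 'a where "of_nat (CARD('a) - 1) = s * s" by blast
    moreover have "(of_nat (CARD('a) - 1) :: 'a) = - 1"
      by (simp add: of_nat_diff of_nat_card_eq_0 Suc_leI)
    ultimately show False using square_neq_minus_1 by metis
  qed
  then obtain a b :: 'a where ab: "a * a + b * b = - 1" by blast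
  moreover have "a \<noteq> 0" "b \<noteq> 0" using ab square_neq_minus_1 by auto
  ultimately show ?thesis using that by blast
qed

section \<open>Null vectors and similitudes\<close>

lemma mink_diff_self_eq_0_iff:
  fixes u v :: "'a ^ 4"
  assumes "mink u u = 0" "mink v v = 0"
  shows "mink (u - v) (u - v) = 0 \<longleftrightarrow> mink u v = 0"
  \<comment> \<open>For null \<open>u\<close> and \<open>v\<close> the norm of \<open>u - v\<close>
    is \<open>- 2 * mink u v\<close>.\<close>
  using assms two_neq_0 by (simp add: mink_linear mink_commute[of v u] flip: mult_2)

text \<open>The Witt index is one: for a = t - z and b = t + z the form is a b - x^2 - y^2, where
  x^2 + y^2 is anisotropic.\<close>

lemma null_orthogonal_parallel:
  fixes u v :: "'a ^ 4"
  assumes u: "mink u u = 0" "u \<noteq> 0" and v: "mink v v = 0" and uv: "mink u v = 0"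
  shows "\<exists>c. v = c *s u"
proof -
  define x y a b where "x = u$1" "y = u$2" "a = u$4 - u$3" "b = u$4 + u$3"
  define x' y' a' b' where "x' = v$1" "y' = v$2" "a' = v$4 - v$3" "b' = v$4 + v$3"
  note defs = x_y_a_b_def x'_y'_a'_b'_def
  have n: "a * b = x * x + y * y" "a' * b' = x' * x' + y' * y'"
    using u v by (simp_all add: defs mink_def algebra_simps)
  have o: "a * b' + a' * b = 2 * (x * x' + y * y')"
    using uv unfolding defs mink_def by algebra
  \<comment> \<open>By \<open>n\<close> and \<open>o\<close> the left side expands to a^2 a'b' +
    a'^2 ab - aa'(ab' + a'b) = 0.\<close>
  have "(a * x' - a' * x) * (a * x' - a' * x) + (a * y' - a' * y) * (a * y' - a' * y) = 0"
    using n o by algebra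
  from sum_squares_eq_0D[OF this] have p: "a * x' = a' * x" "a * y' = a' * y" by simp_all
  have "\<exists>c. x' = c * x \<and> y' = c * y \<and> a' = c * a \<and> b' = c * b"
  proof (cases "a = 0")
    case True
    with n sum_squares_eq_0D have xy: "x = 0" "y = 0" by (metis mult_zero_left)+
    have "b \<noteq> 0"
    proof
      assume "b = 0"
      with True have "u $ 3 = u $ 4" "2 * u $ 4 = 0" unfolding defs by (auto simp: eq_neg_iff_add_eq_0)
      with xy two_neq_0 u(2) show False unfolding defs
        by (auto intro: vec4_eqI)
    qed
    with True o xy have "a' = 0" by auto
    moreover from this n sum_squares_eq_0D have "x' = 0" "y' = 0" by (metis mult_zero_left)+
    ultimately show ?thesis using True xy \<open>b \<noteq> 0\<close> by (intro exI[of _ "b' / b"]) simp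
  next
    case False
    have "a * (a * b') = a * (a' * b)" using n o p by algebra
    with False p show ?thesis by (intro exI[of _ "a' / a"]) (auto simp: field_simps)
  qed
  then obtain c where c: "x' = c * x" "y' = c * y" "a' = c * a" "b' = c * b" by blast
  have "2 * v$4 = 2 * (c * u$4)" "2 * v$3 = 2 * (c * u$3)"
    using c(3,4) unfolding defs by algebra+
  with two_neq_0 c have "v = c *s u"
    by (intro vec4_eqI) (auto simp: defs)
  then show ?thesis ..
qed

text \<open>On (x, y) multiply by the "complex number" a + bi of norm -1; on (z, t) swap the
  coordinates, which negates t^2 - z^2.\<close>

lemma anti_similitude_exists:
  obtains k :: "'a ^ 4 \<Rightarrow> 'a ^ 4"
  where "\<And>x y. k (x + y) = k x + k y" "\<And>x y. mink (k x) (k y) = - mink x y"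
proof -
  obtain a b :: 'a where ab: "a * a + b * b = - 1" using sum_two_squares_minus_1 by blast
  define k :: "'a ^ 4 \<Rightarrow> 'a ^ 4" where
    "k v = vec4 (a * v$1 - b * v$2) (b * v$1 + a * v$2) (v$4) (v$3)" for v
  have "k (x + y) = k x + k y" for x y
    by (rule vec4_eqI) (simp_all add: k_def algebra_simps)
  moreover have "mink (k x) (k y) = - mink x y" for x y
    using ab unfolding k_def mink_def vec4_nth by algebra
  ultimately show ?thesis using that by blast
qed

text \<open>Scaling, possibly after an anti-Lorentz map, equalises the norms; vectors of equal nonzero
  norm are then exchanged by a reflection, up to sign.\<close>

lemma similitude_transitive:
  fixes d d' :: "'a ^ 4"
  assumes "mink d d \<noteq> 0" "mink d' d' \<noteq> 0"
  obtains g l where "l \<noteq> 0" "\<And>x y. g (x + y) = g x + g y" "\<And>x y. mink (g x) (g y) = l * mink x y"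
    "g d = d'"
proof -
  obtain h l where l: "l \<noteq> 0" and add: "\<And>x y. h (x + y) = h x + h y"
    and h: "\<And>x y. mink (h x) (h y) = l * mink x y" and hd: "mink (h d) (h d) = mink d' d'"
  proof -
    obtain s where s: "mink d' d' / mink d d = s * s \<or> mink d' d' / mink d d = - (s * s)"
      using square_or_minus_square by blast
    then have "s \<noteq> 0" using assms by auto
    show ?thesis
    proof (cases "mink d' d' / mink d d = s * s")
      case True
      then show ?thesis using assms \<open>s \<noteq> 0\<close>
        by (intro that[of "s * s" "\<lambda>x. s *s x"])
          (auto simp: mink_linear vector_add_ldistrib field_simps)
    next
      case False
      obtain k :: "'a ^ 4 \<Rightarrow> 'a ^ 4"
        where k: "\<And>x y. k (x + y) = k x + k y" "\<And>x y. mink (k x) (k y) = - mink x y"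
        using anti_similitude_exists by blast
      show ?thesis using assms \<open>s \<noteq> 0\<close> False s
        by (intro that[of "- (s * s)" "\<lambda>x. s *s k x"])
          (auto simp: mink_linear vector_add_ldistrib k field_simps)
    qed
  qed
  define R :: "'a ^ 4 \<Rightarrow> 'a ^ 4 \<Rightarrow> 'a ^ 4" where "R w x = x - (2 * mink x w / mink w w) *s w" for w x
  have R: "R w (x + y) = R w x + R w y" for w x y
    by (rule vec4_eqI) (simp_all add: R_def mink_linear add_divide_distrib algebra_simps)
  have rm: "mink (R w x) (R w y) = mink x y" if "mink w w \<noteq> 0" for w x y
    unfolding R_def by (rule mink_reflection[OF that])
  \<comment> \<open>Parallelogram law: \<open>h d - d'\<close> and \<open>h d + d'\<close> cannot
    both be null, so one of them defines a reflection.\<close>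
  have "mink (h d - d') (h d - d') + mink (h d + d') (h d + d') = 4 * mink d' d'"
    using hd by (simp add: mink_linear algebra_simps)
  with assms four_neq_0 consider
    "mink (h d - d') (h d - d') \<noteq> 0" | "mink (h d + d') (h d + d') \<noteq> 0" by fastforce
  then show ?thesis
  proof cases
    case 1
    let ?w = "h d - d'"
    have "mink ?w ?w = 2 * mink (h d) ?w"
      using hd by (simp add: mink_linear mink_commute)
    with 1 have "R ?w (h d) = d'" by (simp add: R_def)
    then show ?thesis
      using that[of l "\<lambda>x. R ?w (h x)"] by (simp add: l add h R rm[OF 1])
  next
    case 2
    let ?w = "h d + d'"
    have "mink ?w ?w = 2 * mink (h d) ?w"
      using hd by (simp add: mink_linear mink_commute)
    with 2 have "R ?w (h d) = - d'" by (simp add: R_def)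
    then show ?thesis
      using that[of l "\<lambda>x. - R ?w (h x)"]
      by (simp add: l add h R rm[OF 2] mink_minus_left mink_minus_right)
  qed
qed

end

section \<open>Injectivity\<close>

text \<open>These are the endomorphisms of the graph joining distinct points with null
  difference.\<close>

definition null_preserving :: "('a::comm_ring_1 ^ 4 \<Rightarrow> 'a ^ 4) \<Rightarrow> bool" where
  "null_preserving f \<longleftrightarrow> (\<forall>r1 r2. mink (r1 - r2) (r1 - r2) = 0 \<and> r1 \<noteq> r2 \<longrightarrow>
     mink (f r1 - f r2) (f r1 - f r2) = 0 \<and> f r1 \<noteq> f r2)"

lemma null_preservingD:
  assumes "null_preserving f" "mink (x - y) (x - y) = 0"
  shows "mink (f x - f y) (f x - f y) = 0" "x \<noteq> y \<Longrightarrow> f x \<noteq> f y"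
  using assms by (cases "x = y"; auto simp: null_preserving_def mink_linear)+

context finite_field_3_mod_4
begin

section \<open>Counting orthogonal and null vectors\<close>

lemma card_orthogonal:
  fixes u :: "'a ^ 4"
  assumes "u \<noteq> 0"
  shows "card {x. mink x u = 0} = CARD('a) ^ 3"
proof -
  obtain w where w: "mink w u \<noteq> 0"
    using mink_nondegenerate[of u] assms by (metis mink_commute)
  \<comment> \<open>The space splits as the hyperplane orthogonal to \<open>u\<close> plus the line
    spanned by \<open>w\<close>.\<close>
  let ?h = "\<lambda>(c, x). x + c *s w"
  have "bij_betw ?h (UNIV \<times> {x. mink x u = 0}) UNIV"
    using w
    by (intro bij_betwI[where g = "\<lambda>x. (mink x u / mink w u, x - (mink x u / mink w u) *s w)"])
      (auto simp: mink_linear)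
  then have "CARD('a) * card {x. mink x u = 0} = CARD('a) ^ 4"
    by (auto dest!: bij_betw_same_card simp: card_cartesian_product)
  then show ?thesis by (simp add: numeral_eq_Suc)
qed

text \<open>\<open>H\<close> is a union of lines in direction \<open>u\<close>, each meeting
  \<open>S\<close> once; sliding the points of \<open>S \<inter> H\<close> along \<open>u\<close>
  covers \<open>H\<close> without repetition.\<close>

lemma card_transversal:
  fixes u :: "'a ^ 4"
  assumes S: "\<And>x. x \<in> H \<Longrightarrow> \<exists>!c. x + c *s u \<in> S" and H: "\<And>x c. x \<in> H \<Longrightarrow> x + c *s u \<in> H"
  shows "CARD('a) * card (S \<inter> H) = card H"
proof -
  have "bij_betw (\<lambda>(c, x). x + c *s u) (UNIV \<times> (S \<inter> H)) H"
    unfolding bij_betw_def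
  proof
    show "inj_on (\<lambda>(c, x). x + c *s u) (UNIV \<times> (S \<inter> H))"
    proof (rule inj_onI, clarsimp)
      fix c d x y assume xy: "x \<in> S" "y \<in> S" "x \<in> H" and eq: "x + c *s u = y + d *s u"
      have "y = x + (c - d) *s u"
        using eq by (simp add: vector_sub_rdistrib algebra_simps)
      with S[of x] xy have "c - d = 0" by (metis add.right_neutral vector_smult_lzero)
      with eq show "c = d \<and> x = y" by simp
    qed
    show "(\<lambda>(c, x). x + c *s u) ` (UNIV \<times> (S \<inter> H)) = H"
    proof (intro equalityI subsetI)
      fix x assume x: "x \<in> H"
      then obtain c where "x + c *s u \<in> S" using S by blast
      with H x have "(- c, x + c *s u) \<in> UNIV \<times> (S \<inter> H)" by simp
      moreover have "x = (\<lambda>(c, x). x + c *s u) (- c, x + c *s u)" by simp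
      ultimately show "x \<in> (\<lambda>(c, x). x + c *s u) ` (UNIV \<times> (S \<inter> H))" by (rule rev_image_eqI)
    qed (use H in auto)
  qed
  then show ?thesis
    by (auto dest!: bij_betw_same_card simp: card_cartesian_product)
qed

text \<open>With a = t - z and b = t + z, a null vector with a nonzero is determined by
  (x, y, a), and one with a = 0 has x = y = 0.\<close>

lemma card_null_vectors: "card {u :: 'a ^ 4. mink u u = 0} < CARD('a) ^ 3"
proof -
  let ?N = "{u :: 'a ^ 4. mink u u = 0}"
  define h where "h u = (if u$4 = u$3 then (u$3, 0, 0) else (u$1, u$2, u$4 - u$3))" for u :: "'a ^ 4"
  have nu: "(u$4 - u$3) * (u$4 + u$3) = u$1 * u$1 + u$2 * u$2" if "u \<in> ?N" for u :: "'a ^ 4"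
    using that by (simp add: mink_def algebra_simps)
  have nz: "u$1 = 0 \<and> u$2 = 0" if "u \<in> ?N" "u$4 = u$3" for u :: "'a ^ 4"
    using nu[OF that(1)] that(2) sum_squares_eq_0D[of "u$1" "u$2"] by simp
  have inj: "inj_on h ?N"
  proof (rule inj_onI)
    fix u v assume uv: "u \<in> ?N" "v \<in> ?N" and eq: "h u = h v"
    show "u = v"
    proof (cases "u$4 = u$3")
      case True
      with eq have "v$4 = v$3" "u$3 = v$3" by (auto simp: h_def split: if_splits)
      with True nz[of u] nz[of v] uv show ?thesis by (intro vec4_eqI) auto
    next
      case False
      with eq have e: "u$1 = v$1" "u$2 = v$2" "u$4 - u$3 = v$4 - v$3"
        by (auto simp: h_def split: if_splits)
      have "(u$4 - u$3) * (u$4 + u$3) = (u$4 - u$3) * (v$4 + v$3)"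
        using nu[OF uv(1)] nu[OF uv(2)] e by simp
      with False have "u$4 + u$3 = v$4 + v$3" by simp
      then have "2 * u$4 = 2 * v$4" "2 * u$3 = 2 * v$3" using e(3) by algebra+
      with two_neq_0 e show ?thesis by (intro vec4_eqI) auto
    qed
  qed
  \<comment> \<open>The first case of \<open>h\<close> has middle entry 0 and the second a nonzero
    last entry; the missed triple makes the bound strict.\<close>
  have "(0, 1, 0) \<notin> h ` ?N" by (auto simp: h_def)
  then have "h ` ?N \<subset> UNIV" by blast
  then have "card (h ` ?N) < CARD('a \<times> 'a \<times> 'a)" by (intro psubset_card_mono) auto
  with inj show ?thesis by (simp add: card_image numeral_eq_Suc)
qed

text \<open>A similitude reduces \<open>d\<close> to the second basis vector; its null orthogonal
  vectors are those with y = 0, a conic cone with a two-parameter description.\<close>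

lemma card_null_orthogonal:
  fixes d :: "'a ^ 4"
  assumes "mink d d \<noteq> 0"
  shows "CARD('a) ^ 2 \<le> card {u. mink u u = 0 \<and> mink d u = 0}"
proof -
  define e :: "'a ^ 4" where "e = vec4 0 1 0 0"
  have "mink e e \<noteq> 0" by (simp add: e_def mink_def)
  then obtain g l where l: "l \<noteq> 0" and add: "\<And>x y. g (x + y) = g x + g y"
    and g: "\<And>x y. mink (g x) (g y) = l * mink x y" and gd: "g e = d"
    using similitude_transitive[of e d] assms by metis
  have inj: "inj g"
  proof (rule injI)
    fix x y assume "g x = g y"
    then have "g (x - y) = 0" using add[of "x - y" y] by simp
    then have "mink (x - y) z = 0" for z using g[of "x - y" z] l by (simp add: mink_linear)
    then show "x = y" using mink_nondegenerate by fastforce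
  qed
  \<comment> \<open>For nonzero \<open>a\<close>, t - z = 2a and t + z = 2x^2 / a have product
    (2x)^2, the square of the first coordinate.\<close>
  define h :: "'a \<times> 'a \<Rightarrow> 'a ^ 4" where "h = (\<lambda>(a, x). if a = 0 then vec4 0 0 x x
    else vec4 (2 * x) 0 (x * x / a - a) (x * x / a + a))"
  have "inj h"
  proof (rule injI, clarify)
    fix a x b y assume eq: "h (a, x) = h (b, y)"
    have d: "h (a, x) $ 4 - h (a, x) $ 3 = 2 * a" for a x by (simp add: h_def)
    have "2 * a = 2 * b" using d[of a x] d[of b y] unfolding eq by (rule trans[OF sym])
    with two_neq_0 have "a = b" by simp
    moreover have "x = y"
    proof (cases "a = 0")
      case True
      then show ?thesis using arg_cong[OF eq, of "\<lambda>v. v $ 3"] \<open>a = b\<close> by (simp add: h_def)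
    next
      case False
      then show ?thesis using arg_cong[OF eq, of "\<lambda>v. v $ 1"] \<open>a = b\<close> two_neq_0 by (simp add: h_def)
    qed
    ultimately show "a = b \<and> x = y" by simp
  qed
  have "mink (h p) (h p) = 0 \<and> mink e (h p) = 0" for p
    by (cases p) (auto simp: h_def e_def mink_def field_simps)
  then have "range (g \<circ> h) \<subseteq> {u. mink u u = 0 \<and> mink d u = 0}"
    using g gd by (auto simp flip: gd)
  then have "card (range (g \<circ> h)) \<le> card {u. mink u u = 0 \<and> mink d u = 0}"
    by (intro card_mono) auto
  moreover have "card (range (g \<circ> h)) = CARD('a) ^ 2"
    using inj \<open>inj h\<close> by (subst card_image) (auto intro: inj_compose simp: numeral_eq_Suc)
  ultimately show ?thesis by simp
qed

text \<open>Counting the orthogonal pairs of a nonzero null vector u and a nonzero s in S in two ways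
  would force the number of null vectors to be at least q^3.\<close>

lemma no_null_line_transversal:
  fixes S :: "('a ^ 4) set"
  assumes S0: "0 \<in> S" and S: "\<And>u x. mink u u = 0 \<Longrightarrow> u \<noteq> 0 \<Longrightarrow> \<exists>!c. x + c *s u \<in> S"
  shows False
proof -
  let ?q = "CARD('a)"
  let ?U = "{u :: 'a ^ 4. mink u u = 0} - {0}"
  let ?T = "S - {0}"
  have q: "?q > 1" using card_mod_4 by presburger
  \<comment> \<open>Otherwise the null line through 0 and \<open>s\<close> would meet
    \<open>S\<close> twice.\<close>
  have nonnull: "mink s s \<noteq> 0" if "s \<in> ?T" for s
  proof
    assume "mink s s = 0"
    with that S[of s 0] have "\<exists>!c. 0 + c *s s \<in> S" by simp
    then obtain c where "\<forall>d. 0 + d *s s \<in> S \<longrightarrow> d = c" unfolding Ex1_def by (elim exE conjE) (rule that)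
    from this[rule_format, of 0] this[rule_format, of 1] that S0 have "(0::'a) = 1" by simp
    then show False by simp
  qed
  obtain u0 :: "'a ^ 4" where u0: "u0 \<in> ?U"
  proof
    have "vec4 0 0 1 1 \<noteq> (0 :: 'a ^ 4)" by (metis vec4_nth(4) zero_index zero_neq_one)
    then show "vec4 0 0 1 1 \<in> ?U" by (simp add: mink_def)
  qed
  have "?q * card (S \<inter> UNIV) = CARD('a ^ 4)"
  proof (rule card_transversal)
    show "\<exists>!c. x + c *s u0 \<in> S" for x by (rule S) (use u0 in simp_all)
  qed simp
  then have cS: "card S = ?q ^ 3" by (simp add: numeral_eq_Suc)
  have cSu: "card (S \<inter> {x. mink x u = 0}) = ?q ^ 2" if u: "u \<in> ?U" for u
  proof -
    have "?q * card (S \<inter> {x. mink x u = 0}) = card {x. mink x u = 0}"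
    proof (rule card_transversal)
      show "\<exists>!c. x + c *s u \<in> S" for x using S u by blast
      show "x + c *s u \<in> {x. mink x u = 0}" if "x \<in> {x. mink x u = 0}" for x c
        using that u by (simp add: mink_linear)
    qed
    then show ?thesis using card_orthogonal[of u] u by (simp add: numeral_eq_Suc)
  qed
  have "(\<Sum>u\<in>?U. card {s\<in>?T. mink s u = 0}) = (\<Sum>s\<in>?T. card {u\<in>?U. mink s u = 0})"
    by (rule sum_multicount_gen) auto
  moreover have "card {s\<in>?T. mink s u = 0} = ?q ^ 2 - 1" if "u \<in> ?U" for u
  proof -
    have "{s\<in>?T. mink s u = 0} = S \<inter> {x. mink x u = 0} - {0}" by auto
    then show ?thesis using cSu[OF that] S0 by (simp add: card_Diff_singleton mink_linear)
  qed
  moreover have "?q ^ 2 - 1 \<le> card {u\<in>?U. mink s u = 0}" if "s \<in> ?T" for s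
  proof -
    have "{u\<in>?U. mink s u = 0} = {u. mink u u = 0 \<and> mink s u = 0} - {0}" by auto
    then show ?thesis using card_null_orthogonal[OF nonnull[OF that]]
      by (simp add: card_Diff_singleton mink_linear)
  qed
  then have "(\<Sum>s\<in>?T. ?q ^ 2 - 1) \<le> (\<Sum>s\<in>?T. card {u\<in>?U. mink s u = 0})" by (rule sum_mono)
  ultimately have "card ?T * (?q ^ 2 - 1) \<le> card ?U * (?q ^ 2 - 1)" by simp
  moreover have "?q ^ 2 - 1 > 0" using one_less_power[OF q, of 2] by simp
  ultimately have "card ?T \<le> card ?U" by simp
  \<comment> \<open>Zero is null, so removing it really lowers the count by one and the truncated
    subtraction is exact.\<close>
  moreover have "card {u :: 'a ^ 4. mink u u = 0} > 0"
  proof -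
    have "card {0 :: 'a ^ 4} \<le> card {u :: 'a ^ 4. mink u u = 0}"
      by (rule card_mono) (simp_all add: mink_zero_left)
    then show ?thesis by simp
  qed
  ultimately show False
    using cS S0 card_null_vectors by (simp add: card_Diff_singleton mink_linear)
qed

text \<open>Differences from a base point of a clique are null and mutually orthogonal, hence
  parallel: two distinct points already determine the null line containing the clique.\<close>

lemma clique_card_le:
  fixes C :: "('a ^ 4) set"
  assumes C: "\<And>x y. x \<in> C \<Longrightarrow> y \<in> C \<Longrightarrow> mink (x - y) (x - y) = 0"
  shows "card C \<le> CARD('a)"
proof (cases "\<exists>p\<in>C. \<exists>r\<in>C. p \<noteq> r")
  case True
  then obtain p r where pr: "p \<in> C" "r \<in> C" "r \<noteq> p" by blast
  have "C \<subseteq> range (\<lambda>c. p + c *s (r - p))"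
  proof
    fix x assume x: "x \<in> C"
    have "mink ((r - p) - (x - p)) ((r - p) - (x - p)) = 0" using C[OF pr(2) x] by simp
    then have "mink (r - p) (x - p) = 0"
      using mink_diff_self_eq_0_iff C pr(1,2) x by blast
    then obtain c where "x - p = c *s (r - p)"
      using null_orthogonal_parallel[of "r - p" "x - p"] C pr x by auto
    then have "x = p + c *s (r - p)" by (metis add.commute diff_add_cancel)
    then show "x \<in> range (\<lambda>c. p + c *s (r - p))" by blast
  qed
  then have "card C \<le> card (range (\<lambda>c. p + c *s (r - p)))" by (intro card_mono) auto
  also have "\<dots> \<le> CARD('a)" by (rule card_image_le) simp
  finally show ?thesis .
next
  case False
  then have "card C \<le> 1" using card_le_Suc0_iff_eq[of C] by auto
  also have "1 \<le> CARD('a)" by (simp add: Suc_leI)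
  finally show ?thesis .
qed

text \<open>The core argument of Cameron and Kazanidis: take an endomorphism with the smallest image.
  Non-adjacent pairs form a single orbit, so if the image contained one, moving it to a pair that
  is identified by f would give a smaller image. Hence the image is a clique, and a fibre
  meets every null line exactly once.\<close>

lemma null_preserving_inj:
  fixes f :: "'a ^ 4 \<Rightarrow> 'a ^ 4"
  assumes f: "null_preserving f"
  shows "inj f"
proof (rule ccontr)
  assume "\<not> inj f"
  then obtain a b where ab: "f a = f b" "a \<noteq> b" by (auto simp: inj_def)
  then have nab: "mink (a - b) (a - b) \<noteq> 0" using null_preservingD[OF f] by blast
  obtain h :: "'a ^ 4 \<Rightarrow> 'a ^ 4" where h: "null_preserving h"
    and min: "\<And>k :: 'a ^ 4 \<Rightarrow> 'a ^ 4. null_preserving k \<Longrightarrow> card (range h) \<le> card (range k)"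
    using ex_has_least_nat[of null_preserving f "\<lambda>k. card (range k)"] f by blast
  have clique: "mink (c - d) (c - d) = 0" if cd: "c \<in> range h" "d \<in> range h" for c d
  proof (rule ccontr)
    assume ncd: "mink (c - d) (c - d) \<noteq> 0"
    obtain g l where l: "l \<noteq> 0" and add: "\<And>x y. g (x + y) = g x + g y"
      and g: "\<And>x y. mink (g x) (g y) = l * mink x y" and gd: "g (c - d) = a - b"
      using similitude_transitive[OF ncd nab] by metis
    have diff: "g (x - y) = g x - g y" for x y using add[of "x - y" y] by simp
    have g0: "x = 0" if "g x = 0" for x
    proof -
      have "mink x z = 0" for z using g[of x z] l that by (simp add: mink_linear)
      then show ?thesis by (rule mink_nondegenerate)
    qed
    \<comment> \<open>\<open>k\<close> first moves the pair \<open>c\<close>, \<open>d\<close> to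
      \<open>a\<close>, \<open>b\<close>, which \<open>f\<close> then identifies.\<close>
    define k where "k x = f (g (x - d) + b)" for x
    have "null_preserving (k \<circ> h)"
      unfolding null_preserving_def
    proof (intro allI impI)
      fix x y :: "'a ^ 4" assume xy: "mink (x - y) (x - y) = 0 \<and> x \<noteq> y"
      let ?z = "g (h x - d) + b" and ?w = "g (h y - d) + b"
      have zw: "?z - ?w = g (h x - h y)" by (simp add: diff)
      have "mink (h x - h y) (h x - h y) = 0" "h x \<noteq> h y" using null_preservingD[OF h] xy by auto
      then have "mink (?z - ?w) (?z - ?w) = 0" "?z - ?w \<noteq> 0"
        using g g0[of "h x - h y"] unfolding zw by auto
      then have "mink (?z - ?w) (?z - ?w) = 0" "?z \<noteq> ?w" by auto
      then show "mink ((k \<circ> h) x - (k \<circ> h) y) ((k \<circ> h) x - (k \<circ> h) y) = 0 \<and> (k \<circ> h) x \<noteq> (k \<circ> h) y"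
        using null_preservingD[OF f, of ?z ?w] by (simp add: k_def)
    qed
    then have "card (range h) \<le> card (k ` range h)" using min[of "k \<circ> h"] by (simp add: image_comp comp_def)
    then have "inj_on k (range h)" by (simp add: card_image_le eq_card_imp_inj_on le_antisym)
    moreover have "k c = k d"
      using gd ab(1) diff[of 0 0] by (simp add: k_def)
    moreover have "c \<noteq> d" using ncd by (auto simp: mink_linear)
    ultimately show False using cd by (meson inj_onD)
  qed
  define S where "S = {x. h x = h 0}"
  have "\<exists>!c. x + c *s u \<in> S" if u: "mink u u = 0" "u \<noteq> 0" for u x
  proof -
    \<comment> \<open>\<open>h\<close> is injective on a null line, whose q image points must fill
      the clique \<open>range h\<close>; hence the value \<open>h 0\<close> is taken exactly once on
      it.\<close>
    let ?p = "\<lambda>c. h (x + c *s u)"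
    have "inj ?p"
    proof (rule injI, rule ccontr)
      fix c d assume eq: "?p c = ?p d" and "c \<noteq> d"
      have e: "x + c *s u - (x + d *s u) = (c - d) *s u" by (simp add: vector_sub_rdistrib)
      with u have "mink (x + c *s u - (x + d *s u)) (x + c *s u - (x + d *s u)) = 0"
        by (simp only: mink_linear) simp
      moreover have "x + c *s u \<noteq> x + d *s u" using e u \<open>c \<noteq> d\<close> by auto
      ultimately show False using null_preservingD(2)[OF h] eq by blast
    qed
    then have "card (range ?p) = CARD('a)" by (simp add: card_image)
    moreover have "card (range h) \<le> CARD('a)" using clique by (rule clique_card_le)
    moreover have "range ?p \<subseteq> range h" by auto
    ultimately have "range ?p = range h" by (intro card_seteq) auto
    then have "h 0 \<in> range ?p" by simp
    then obtain c where "h (x + c *s u) = h 0" by auto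
    moreover have "d = c" if "h (x + d *s u) = h 0" for d
      using injD[OF \<open>inj ?p\<close>, of d c] that calculation by simp
    ultimately show ?thesis unfolding S_def by blast
  qed
  moreover have "0 \<in> S" by (simp add: S_def)
  ultimately show False by (intro no_null_line_transversal[of S])
qed

end

section \<open>Null lines and additivity\<close>

text \<open>Carrying the inverse \<open>g\<close> explicitly makes the setting symmetric, so every
  result for \<open>f\<close> transfers to \<open>g\<close> through \<open>swap\<close>.\<close>

locale null_automorphism = finite_field_3_mod_4 ty for ty :: "'a::{finite,field} itself" +
  fixes f g :: "'a ^ 4 \<Rightarrow> 'a ^ 4"
  assumes f: "null_preserving f" and g: "null_preserving g"
    and gf: "\<And>x. g (f x) = x" and fg: "\<And>x. f (g x) = x"
begin

lemma swap: "null_automorphism g f"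
  using f g gf fg by unfold_locales auto

lemma f_eq_iff: "f x = f y \<longleftrightarrow> x = y"
  using gf by metis

lemma null_diff_iff: "mink (f x - f y) (f x - f y) = 0 \<longleftrightarrow> mink (x - y) (x - y) = 0"
  using null_preservingD(1)[OF f, of x y] null_preservingD(1)[OF g, of "f x" "f y"]
  by (auto simp: gf)

text \<open>Three points of a null line form a clique; so do their images, which are therefore
  collinear.\<close>

lemma null_line_image:
  assumes "mink u u = 0"
  obtains d where "f (a + c *s u) = f a + d *s (f (a + u) - f a)"
proof (cases "u = 0")
  case True
  then show ?thesis using that[of 0] by simp
next
  case False
  let ?v = "f (a + u) - f a" and ?w = "f (a + c *s u) - f a"
  have v: "mink ?v ?v = 0" "?v \<noteq> 0"
    using null_diff_iff[of "a + u" a] assms False by (simp_all add: f_eq_iff)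
  have w: "mink ?w ?w = 0"
    using null_diff_iff[of "a + c *s u" a] assms by (simp add: mink_linear)
  have "a + u - (a + c *s u) = (1 - c) *s u" by (simp add: vector_sub_rdistrib)
  then have "mink (f (a + u) - f (a + c *s u)) (f (a + u) - f (a + c *s u)) = 0"
    unfolding null_diff_iff by (simp only: mink_scale_left mink_scale_right assms mult_zero_right)
  then have "mink (?v - ?w) (?v - ?w) = 0" by simp
  then have "mink ?v ?w = 0" using mink_diff_self_eq_0_iff v w by blast
  then obtain d where "?w = d *s ?v" using null_orthogonal_parallel v w by blast
  then have "f (a + c *s u) = f a + d *s ?v" by (metis add.commute diff_add_cancel)
  then show ?thesis by (rule that)
qed

lemma null_line_surj:
  assumes "mink u u = 0"
  obtains c where "f (a + c *s u) = f a + s *s (f (a + u) - f a)"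
proof -
  interpret inv: null_automorphism ty g f by (rule swap)
  let ?v = "f (a + u) - f a"
  have "mink ?v ?v = 0" using null_diff_iff[of "a + u" a] assms by simp
  then obtain c where "g (f a + s *s ?v) = g (f a) + c *s (g (f a + ?v) - g (f a))"
    by (rule inv.null_line_image)
  then have "g (f a + s *s ?v) = a + c *s u" by (simp add: gf)
  then have "f (a + c *s u) = f a + s *s ?v" by (metis fg)
  then show ?thesis by (rule that)
qed

text \<open>A point off the null line a + F u is null-related to no point of it iff it lies in the
  tangent hyperplane a + u^perp, so these hyperplanes are preserved.\<close>

lemma tangent_hyperplane_image:
  assumes u: "mink u u = 0" and b: "mink (b - a) u = 0"
  shows "mink (f b - f a) (f (a + u) - f a) = 0"
proof (cases "u = 0")
  case False
  let ?v = "f (a + u) - f a" and ?w = "f b - f a"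
  have v: "mink ?v ?v = 0" using null_diff_iff[of "a + u" a] u by simp
  show ?thesis
  proof (rule ccontr)
    assume m: "mink ?w ?v \<noteq> 0"
    \<comment> \<open>As \<open>?v\<close> is null, the norm of \<open>?w - s *s ?v\<close> is
      linear in \<open>s\<close>; this is its root, so \<open>f b\<close> is null-related to a point
      of the image line.\<close>
    define s where "s = mink ?w ?w / (2 * mink ?w ?v)"
    obtain c where c: "f (a + c *s u) = f a + s *s ?v" using null_line_surj[OF u] by blast
    have "mink (?w - s *s ?v) (?w - s *s ?v) = mink ?w ?w - s * (2 * mink ?w ?v)"
      unfolding mink_diff_left[of ?w] mink_diff_right[of _ ?w] mink_scale_left mink_scale_right v
        mink_commute[of ?v ?w] by (simp add: algebra_simps)
    also have "\<dots> = 0" using m two_neq_0 by (simp add: s_def)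
    finally have "mink (f b - f (a + c *s u)) (f b - f (a + c *s u)) = 0"
      by (simp add: c diff_diff_eq)
    then have "mink (b - (a + c *s u)) (b - (a + c *s u)) = 0" by (simp add: null_diff_iff)
    moreover have "b - (a + c *s u) = (b - a) - c *s u" by simp
    ultimately have "mink ((b - a) - c *s u) ((b - a) - c *s u) = 0" by metis
    \<comment> \<open>Subtracting \<open>c *s u\<close> leaves the norm unchanged, since
      \<open>u\<close> is null and orthogonal to \<open>b - a\<close>. Thus \<open>b\<close> lies on
      the null line itself, contradicting \<open>m\<close>.\<close>
    then have "mink (b - a) (b - a) = 0"
      unfolding mink_diff_left[of "b - a"] mink_diff_right[of _ "b - a"]
      by (simp add: mink_scale_left mink_scale_right u b mink_commute[of u "b - a"])
    then obtain d where "b - a = d *s u"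
      using null_orthogonal_parallel[OF u False] b mink_commute by metis
    then have bd: "b = a + d *s u" by (metis add.commute diff_add_cancel)
    obtain e where "f b = f a + e *s ?v" unfolding bd using null_line_image[OF u] by blast
    then have "mink ?w ?v = e * mink ?v ?v" by (simp only: add_diff_cancel_left' mink_scale_left)
    with v m show False by simp
  qed
qed (simp add: mink_linear)

lemma tangent_hyperplane_image_iff:
  assumes u: "mink u u = 0"
  shows "mink (f b - f a) (f (a + u) - f a) = 0 \<longleftrightarrow> mink (b - a) u = 0"
proof
  interpret inv: null_automorphism ty g f by (rule swap)
  let ?v = "f (a + u) - f a"
  assume "mink (f b - f a) ?v = 0"
  moreover have "mink ?v ?v = 0" using null_diff_iff[of "a + u" a] u by simp
  ultimately have "mink (g (f b) - g (f a)) (g (f a + ?v) - g (f a)) = 0"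
    by (intro inv.tangent_hyperplane_image)
  then show "mink (b - a) u = 0" by (simp add: gf)
qed (rule tangent_hyperplane_image[OF u])

end

section \<open>A null basis and independence of null vectors\<close>

lemma (in finite_field_3_mod_4) null_basis_induct:
  fixes x :: "'a ^ 4"
  assumes "\<And>c. P (c *s vec4 1 0 0 1)" "\<And>c. P (c *s vec4 (- 1) 0 0 1)"
    "\<And>c. P (c *s vec4 0 1 0 1)" "\<And>c. P (c *s vec4 0 0 1 1)"
    and add: "\<And>x y. P x \<Longrightarrow> P y \<Longrightarrow> P (x + y)"
  shows "P x"
proof -
  have h: "a / 2 + a / 2 = a" for a :: 'a using two_neq_0 by (simp flip: mult_2)
  \<comment> \<open>The y and z coordinates fix the last two coefficients; the first two then have
    sum t - y - z and difference x.\<close>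
  have "x = ((x$4 - x$2 - x$3 + x$1) / 2) *s vec4 1 0 0 1 + ((x$4 - x$2 - x$3 - x$1) / 2) *s vec4 (- 1) 0 0 1
     + x$2 *s vec4 0 1 0 1 + x$3 *s vec4 0 0 1 1"
    using two_neq_0 four_neq_0 by (intro vec4_eqI) (simp_all add: field_simps h)
  then show ?thesis using assms by metis
qed

text \<open>The Gram matrix has zero diagonal, and its determinant is twice the product of the three
  pairings.\<close>

lemma (in finite_field_3_mod_4) null_combination_eq_0:
  fixes p q r :: "'a ^ 4"
  assumes null: "mink p p = 0" "mink q q = 0" "mink r r = 0"
    and "mink p q \<noteq> 0" "mink q r \<noteq> 0" "mink p r \<noteq> 0"
    and eq: "a *s p + b *s q + c *s r = 0"
  shows "a = 0" "b = 0" "c = 0"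
proof -
  have "mink (a *s p + b *s q + c *s r) p = 0" "mink (a *s p + b *s q + c *s r) q = 0"
    "mink (a *s p + b *s q + c *s r) r = 0"
    by (simp_all add: eq mink_linear)
  then have e: "b * mink p q + c * mink p r = 0" "a * mink p q + c * mink q r = 0"
    "a * mink p r + b * mink q r = 0"
    by (simp_all add: mink_linear null mink_commute[of q p] mink_commute[of r p] mink_commute[of r q])
  have "2 * mink q r * (b * mink p q) = 0" "2 * mink p r * (a * mink p q) = 0"
    "2 * mink q r * (c * mink p r) = 0"
    using e by algebra+
  with assms two_neq_0 show "a = 0" "b = 0" "c = 0" by auto
qed

locale null_automorphism_0 = null_automorphism ty f g
  for ty :: "'a::{finite,field} itself" and f g +
  assumes f_0: "f 0 = 0"
begin

lemma f_eq_0_iff: "f x = 0 \<longleftrightarrow> x = 0"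
  using f_eq_iff[of x 0] f_0 by simp

lemma null_image: "mink u u = 0 \<Longrightarrow> mink (f u) (f u) = 0"
  using null_diff_iff[of u 0] f_0 by simp

lemma null_orthogonal_image_iff:
  assumes "mink u u = 0" "mink v v = 0"
  shows "mink (f u) (f v) = 0 \<longleftrightarrow> mink u v = 0"
  using null_diff_iff[of u v] mink_diff_self_eq_0_iff assms null_image by metis

text \<open>Disjoint tangent hyperplanes are parallel, so parallel null lines have parallel images.\<close>

lemma parallel_null_line_image:
  assumes u: "mink u u = 0"
  obtains c where "f (y + u) = f y + c *s f u"
proof (cases "u = 0")
  case True
  then show ?thesis using that[of 0] by simp
next
  case False
  let ?v = "f (y + u) - f y"
  have v: "mink ?v ?v = 0" using null_diff_iff[of "y + u" y] u by simp
  have fu: "mink (f u) (f u) = 0" "f u \<noteq> 0" using null_image u False f_eq_0_iff by auto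
  have "mink (f u) ?v = 0"
  proof (rule ccontr)
    assume m: "mink (f u) ?v \<noteq> 0"
    \<comment> \<open>With this \<open>s\<close> the point \<open>s *s f u\<close> lies in the
      tangent hyperplane of the image line at \<open>f y\<close>; pulling back forces
      \<open>y\<close> to be orthogonal to \<open>u\<close>.\<close>
    define s where "s = mink (f y) ?v / mink (f u) ?v"
    obtain c where "f (0 + c *s u) = f 0 + s *s (f (0 + u) - f 0)" using null_line_surj[OF u] by blast
    then have c: "f (c *s u) = s *s f u" by (simp add: f_0)
    have "mink (f (c *s u) - f y) ?v = s * mink (f u) ?v - mink (f y) ?v"
      by (simp only: c mink_diff_left[of _ "f y"] mink_scale_left)
    also have "\<dots> = 0" using m by (simp add: s_def)
    finally have "mink (c *s u - y) u = 0" by (simp add: tangent_hyperplane_image_iff[OF u])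
    with u have y: "mink y u = 0" by (simp add: mink_linear)
    with u have yu: "mink (y + u) u = 0" by (simp add: mink_linear)
    \<comment> \<open>Now \<open>y\<close> and \<open>y + u\<close> lie in the tangent hyperplane
      through 0, so \<open>?v\<close>, the difference of their images, is orthogonal to
      \<open>f u\<close> after all.\<close>
    have "mink (f y) (f u) = 0" "mink (f (y + u)) (f u) = 0"
      using tangent_hyperplane_image[OF u, of y 0] tangent_hyperplane_image[OF u, of "y + u" 0] y yu
      by (simp_all add: f_0)
    then show False using m by (simp add: mink_commute[of "f u"] mink_linear)
  qed
  then obtain c where "?v = c *s f u" using null_orthogonal_parallel fu v by blast
  then have "f (y + u) = f y + c *s f u" by (metis add.commute diff_add_cancel)
  then show ?thesis by (rule that)
qed

text \<open>Image sides stay parallel to \<open>f u\<close> or \<open>f v\<close>. Comparing the two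
  paths to the opposite corner and pairing with the null vector \<open>f v\<close> isolates the
  coefficients of \<open>f u\<close>.\<close>

lemma null_parallelogram_image:
  assumes u: "mink u u = 0" and v: "mink v v = 0" and uv: "mink u v \<noteq> 0"
  shows "f (y + v + u) - f (y + v) = f (y + u) - f y"
proof -
  obtain a where a: "f (y + u) = f y + a *s f u" using parallel_null_line_image[OF u] by blast
  obtain b where b: "f (y + v) = f y + b *s f v" using parallel_null_line_image[OF v] by blast
  obtain c where c: "f (y + v + u) = f (y + v) + c *s f u"
    using parallel_null_line_image[OF u] by blast
  obtain d where d: "f (y + u + v) = f (y + u) + d *s f v"
    using parallel_null_line_image[OF v] by blast
  have "f (y + v + u) = f (y + u + v)" by (simp add: ac_simps)
  then have "f y + (b *s f v + c *s f u) = f y + (a *s f u + d *s f v)"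
    unfolding a b c d by (simp only: add.assoc)
  then have "b *s f v + c *s f u = a *s f u + d *s f v" by (rule add_left_imp_eq)
  then have "mink (b *s f v + c *s f u) (f v) = mink (a *s f u + d *s f v) (f v)" by simp
  then have "c * mink (f u) (f v) = a * mink (f u) (f v)"
    by (simp add: mink_linear null_image[OF v])
  with uv have "c = a" using null_orthogonal_image_iff[OF u v] by simp
  with a c show ?thesis by simp
qed

text \<open>The difference f (x + u) - f x is unchanged when x moves along a null vector not orthogonal
  to u; a null vector orthogonal to u is a sum of three that are not.\<close>

lemma null_translation_image:
  assumes u: "mink u u = 0"
  shows "f (y + u) = f y + f u"
proof (cases "u = 0")
  case False
  define P where "P w \<longleftrightarrow> (\<forall>x. f (x + w + u) - f (x + w) = f (x + u) - f x)" for w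
  have add: "P (v + w)" if "P v" "P w" for v w
  proof -
    have "f (x + (v + w) + u) - f (x + (v + w)) = f (x + u) - f x" for x
      using that[unfolded P_def, rule_format, of "x + v"] that(1)[unfolded P_def, rule_format, of x]
      by (simp add: add.assoc)
    then show ?thesis by (simp add: P_def)
  qed
  have trans: "P w" if "mink w w = 0" "mink w u \<noteq> 0" for w
    using null_parallelogram_image[OF u that(1)] that(2) by (auto simp: P_def mink_commute)
  \<comment> \<open>If \<open>e\<close> is orthogonal to \<open>u\<close>, then \<open>u\<close> is
    a multiple of \<open>e\<close>, so the summands, not orthogonal to \<open>e\<close>, are not
    orthogonal to \<open>u\<close>.\<close>
  have sum: "P e" if e: "mink e e = 0" "e \<noteq> 0" "e = w1 + w2 + w3"
    and w: "mink w1 w1 = 0" "mink w2 w2 = 0" "mink w3 w3 = 0"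
      "mink w1 e \<noteq> 0" "mink w2 e \<noteq> 0" "mink w3 e \<noteq> 0" for e w1 w2 w3
  proof (cases "mink e u = 0")
    case True
    then obtain k where k: "u = k *s e" using null_orthogonal_parallel[OF e(1,2) u] by blast
    with False have "k \<noteq> 0" by auto
    with w k have "mink w1 u \<noteq> 0" "mink w2 u \<noteq> 0" "mink w3 u \<noteq> 0" by (simp_all add: mink_linear)
    with w trans have "P w1" "P w2" "P w3" by blast+
    with add e(3) show ?thesis by simp
  qed (use e trans in blast)
  have P0: "P 0" by (simp add: P_def)
  have "P y"
  proof (rule null_basis_induct[of P])
    fix c :: 'a
    \<comment> \<open>Two opposite null vectors from another axis sum to (0,0,0,2); subtracting the
      mirror image of the given vector leaves that vector. The other three cases are alike.\<close>
    show "P (c *s vec4 1 0 0 1)"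
    proof (cases "c = 0")
      case False
      then show ?thesis using two_neq_0
        by (intro sum[of _ "c *s vec4 0 1 0 1" "c *s vec4 0 (- 1) 0 1" "- c *s vec4 (- 1) 0 0 1"])
          (auto simp: mink_scale_left mink_scale_right mink_def vec_eq_iff forall_4)
    qed (simp add: P0)
    show "P (c *s vec4 (- 1) 0 0 1)"
    proof (cases "c = 0")
      case False
      then show ?thesis using two_neq_0
        by (intro sum[of _ "c *s vec4 0 1 0 1" "c *s vec4 0 (- 1) 0 1" "- c *s vec4 1 0 0 1"])
          (auto simp: mink_scale_left mink_scale_right mink_def vec_eq_iff forall_4)
    qed (simp add: P0)
    show "P (c *s vec4 0 1 0 1)"
    proof (cases "c = 0")
      case False
      then show ?thesis using two_neq_0
        by (intro sum[of _ "c *s vec4 1 0 0 1" "c *s vec4 (- 1) 0 0 1" "- c *s vec4 0 (- 1) 0 1"])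
          (auto simp: mink_scale_left mink_scale_right mink_def vec_eq_iff forall_4)
    qed (simp add: P0)
    show "P (c *s vec4 0 0 1 1)"
    proof (cases "c = 0")
      case False
      then show ?thesis using two_neq_0
        by (intro sum[of _ "c *s vec4 1 0 0 1" "c *s vec4 (- 1) 0 0 1" "- c *s vec4 0 0 (- 1) 1"])
          (auto simp: mink_scale_left mink_scale_right mink_def vec_eq_iff forall_4)
    qed (simp add: P0)
  qed (rule add)
  then have "f (0 + y + u) - f (0 + y) = f (0 + u) - f 0" unfolding P_def by blast
  then show ?thesis by (simp add: f_0 algebra_simps)
qed (simp add: f_0)

text \<open>Every vector is a sum of null vectors, and translation by each of these is already
  additive.\<close>

lemma additive: "f (x + y) = f x + f y"
proof -
  have "\<forall>x. f (x + y) = f x + f y"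
  proof (rule null_basis_induct[of "\<lambda>y. \<forall>x. f (x + y) = f x + f y"])
    fix v w assume v: "\<forall>x. f (x + v) = f x + f v" and w: "\<forall>x. f (x + w) = f x + f w"
    show "\<forall>x. f (x + (v + w)) = f x + f (v + w)"
    proof
      fix x
      show "f (x + (v + w)) = f x + f (v + w)"
        using w[rule_format, of "x + v"] w[rule_format, of v] v[rule_format, of x]
        by (simp add: add.assoc)
    qed
  qed (intro allI null_translation_image, simp add: mink_def)+
  then show ?thesis by blast
qed

lemma f_minus: "f (- x) = - f x"
  using additive[of "- x" x] by (simp add: f_0 eq_neg_iff_add_eq_0)

text \<open>In a null vector p + q + r with pairwise non-orthogonal null summands all scaling functions
  agree. Multiplicativity comes from the null vectors (1,0,0,1) + c (-1,0,0,1) + e (0,1,0,1) with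
  e = -2c / (1 + c).\<close>

lemma semilinear: "\<exists>\<tau>. field_aut \<tau> \<and> (\<forall>c x. f (c *s x) = \<tau> c *s f x)"
proof -
  have "\<exists>d. mink u u = 0 \<longrightarrow> f (c *s u) = d *s f u" for u c
    using null_line_image[of u 0 c] by (metis add_0 diff_zero f_0)
  then obtain t where t: "\<And>u c. mink u u = 0 \<Longrightarrow> f (c *s u) = t u c *s f u" by metis
  have rel: "t p c = t q c" "t p c = t r c"
    if n: "mink p p = 0" "mink q q = 0" "mink r r = 0" "mink (p + q + r) (p + q + r) = 0"
      and m: "mink p q \<noteq> 0" "mink q r \<noteq> 0" "mink p r \<noteq> 0" for p q r c
  proof -
    let ?w = "t (p + q + r) c"
    have "f (c *s (p + q + r)) = ?w *s (f p + f q + f r)"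
      using t[OF n(4)] by (simp add: additive)
    moreover have "f (c *s (p + q + r)) = t p c *s f p + t q c *s f q + t r c *s f r"
      using n t by (simp add: additive vector_add_ldistrib)
    ultimately have "(?w - t p c) *s f p + (?w - t q c) *s f q + (?w - t r c) *s f r = 0"
      by (simp add: vector_sub_rdistrib vector_add_ldistrib algebra_simps)
    \<comment> \<open>The images of \<open>p\<close>, \<open>q\<close>, \<open>r\<close> are again
      null and pairwise non-orthogonal, so all three coefficients vanish.\<close>
    from null_combination_eq_0[OF _ _ _ _ _ _ this]
    show "t p c = t q c" "t p c = t r c"
      using n m null_image null_orthogonal_image_iff by auto
  qed
  have tneg: "t (- u) c = t u c" if "mink u u = 0" "u \<noteq> 0" for u c
  proof -
    have "mink (- u) (- u) = 0" using that by (simp add: mink_linear)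
    from t[OF this, of c] have "f (- (c *s u)) = t (- u) c *s f (- u)" by simp
    then have "t u c *s f u = t (- u) c *s f u" using t[OF that(1)] by (simp add: f_minus)
    then show ?thesis using that f_eq_0_iff[of u] by (simp add: vector_mul_rcancel)
  qed
  let ?ap = "vec4 1 0 0 1 :: 'a ^ 4" and ?am = "vec4 (- 1) 0 0 1 :: 'a ^ 4"
  let ?bp = "vec4 0 1 0 1 :: 'a ^ 4" and ?cp = "vec4 0 0 1 1 :: 'a ^ 4"
  define \<tau> where "\<tau> = t ?ap"
  have null: "mink ?ap ?ap = 0" "mink ?am ?am = 0" "mink ?bp ?bp = 0" "mink ?cp ?cp = 0"
    and nz: "?ap \<noteq> 0" "?am \<noteq> 0" "?bp \<noteq> 0" "?cp \<noteq> 0"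
    by (simp_all add: mink_def vec_eq_iff forall_4)
  have ap: "t ?ap = \<tau>" by (simp add: \<tau>_def)
  \<comment> \<open>The sum of \<open>?ap\<close>, \<open>?am\<close> and \<open>- ?bp\<close> is
    the null vector (0,-1,0,1).\<close>
  have am: "t ?am = \<tau>" and "t (- ?bp) = \<tau>"
    using rel[of ?ap ?am "- ?bp"] two_neq_0 by (auto simp: \<tau>_def mink_def fun_eq_iff)
  then have bp: "t ?bp = \<tau>" using tneg[OF null(3) nz(3)] by (simp add: fun_eq_iff)
  have "t (- ?cp) = \<tau>"
    using rel[of ?ap ?am "- ?cp"] two_neq_0 by (auto simp: \<tau>_def mink_def fun_eq_iff)
  then have cp: "t ?cp = \<tau>" using tneg[OF null(4) nz(4)] by (simp add: fun_eq_iff)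
  have scaled: "t (c *s ?am) = \<tau>" if "c \<noteq> 0" for c
  proof (cases "c = - 1")
    case True
    then show ?thesis using tneg[OF null(2) nz(2)] am by (simp add: fun_eq_iff)
  next
    case False
    then have c: "1 + c \<noteq> 0" by (metis add.commute add_eq_0_iff)
    define e where "e = - 2 * c / (1 + c)"
    have e: "e \<noteq> 0" "e * (1 + c) = - 2 * c" using c that two_neq_0 by (auto simp: e_def)
    have "mink (?ap + c *s ?am + e *s ?bp) (?ap + c *s ?am + e *s ?bp) = 4 * c + 2 * (e * (1 + c))"
      by (simp add: mink_def algebra_simps)
    also have "\<dots> = 0" by (simp add: e(2))
    finally have w: "mink (?ap + c *s ?am + e *s ?bp) (?ap + c *s ?am + e *s ?bp) = 0" .
    have "t ?ap d = t (c *s ?am) d" for d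
    proof (rule rel(1)[OF _ _ _ w])
      show "mink ?ap (c *s ?am) \<noteq> 0" "mink (c *s ?am) (e *s ?bp) \<noteq> 0" "mink ?ap (e *s ?bp) \<noteq> 0"
        using that e(1) two_neq_0 by (simp_all add: mink_scale_left mink_scale_right mink_def)
    qed (simp_all add: mink_scale_left mink_scale_right null)
    then show ?thesis by (simp add: \<tau>_def fun_eq_iff)
  qed
  note cancel = vector_mul_rcancel
  have fam: "f (c *s ?am) = \<tau> c *s f ?am" for c using t[OF null(2)] am by simp
  have fz: "f ?am \<noteq> 0" using nz f_eq_0_iff by blast
  have tau_add: "\<tau> (c + d) = \<tau> c + \<tau> d" for c d
  proof -
    have "\<tau> (c + d) *s f ?am = (\<tau> c + \<tau> d) *s f ?am"
      using additive[of "c *s ?am" "d *s ?am"] by (simp only: fam flip: vec.scale_left_distrib)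
    then show ?thesis using fz by (simp only: cancel) simp
  qed
  have tau0: "\<tau> 0 = 0" using tau_add[of 0 0] by (metis add.right_neutral add_left_cancel)
  \<comment> \<open>Scale \<open>d *s ?am\<close> by \<open>c\<close>, once with its own scaling
    function and once as the multiple \<open>c * d\<close> of \<open>?am\<close>.\<close>
  have tau_mult: "\<tau> (c * d) = \<tau> c * \<tau> d" for c d
  proof (cases "d = 0")
    case False
    have "mink (d *s ?am) (d *s ?am) = 0" by (simp add: mink_scale_left mink_scale_right null)
    from t[OF this, of c] have "f ((c * d) *s ?am) = \<tau> c *s f (d *s ?am)" by (simp add: scaled[OF False])
    then have "\<tau> (c * d) *s f ?am = (\<tau> c * \<tau> d) *s f ?am" by (simp add: fam)
    then show ?thesis using fz by (simp add: cancel)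
  qed (simp add: tau0)
  have tau1: "\<tau> 1 = 1"
  proof -
    have "\<tau> 1 *s f ?am = 1 *s f ?am" using fam[of 1] by simp
    then show ?thesis using fz by (simp only: cancel) simp
  qed
  have "inj \<tau>"
  proof (rule injI)
    fix c d assume "\<tau> c = \<tau> d"
    then have "f (c *s ?am) = f (d *s ?am)" by (simp add: fam)
    then show "c = d" using nz by (simp add: f_eq_iff)
  qed
  then have "bij \<tau>" by (simp add: bij_def finite_UNIV_inj_surj)
  then have "field_aut \<tau>" by (simp add: field_aut_def tau_add tau_mult tau1)
  moreover have "f (c *s x) = \<tau> c *s f x" for c x
  proof -
    have "\<forall>c. f (c *s x) = \<tau> c *s f x"
    proof (rule null_basis_induct[of "\<lambda>x. \<forall>c. f (c *s x) = \<tau> c *s f x"])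
      fix d
      have step: "f (c *s (d *s u)) = \<tau> c *s f (d *s u)" if "mink u u = 0" "t u = \<tau>" for c u
        using t[OF that(1)] that(2) by (simp add: tau_mult)
      show "\<forall>c. f (c *s (d *s ?ap)) = \<tau> c *s f (d *s ?ap)"
        by (intro allI step null(1) ap)
      show "\<forall>c. f (c *s (d *s ?am)) = \<tau> c *s f (d *s ?am)"
        by (intro allI step null(2) am)
      show "\<forall>c. f (c *s (d *s ?bp)) = \<tau> c *s f (d *s ?bp)"
        by (intro allI step null(3) bp)
      show "\<forall>c. f (c *s (d *s ?cp)) = \<tau> c *s f (d *s ?cp)"
        by (intro allI step null(4) cp)
    qed (simp add: vector_add_ldistrib additive)
    then show ?thesis by blast
  qed
  ultimately show ?thesis by blast
qed

end

section \<open>The matrix of an endomorphism\<close>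

lemma matrix_vector_mult_columns_4:
  fixes A :: "'a::comm_ring_1 ^ 4 ^ 4"
  shows "A *v x = x$1 *s column 1 A + x$2 *s column 2 A + x$3 *s column 3 A + x$4 *s column 4 A"
  by (simp add: vec_eq_iff matrix_vector_mult_def sum_4 column_def mult.commute)

text \<open>The form of A is tested on the null vectors e4 + e_i, e4 - e_i and (s a, t b, 1, 0), where
  s and t are signs and a^2 + b^2 = -1.\<close>

lemma (in finite_field_3_mod_4) similitude_if_null_preserved:
  fixes A :: "'a ^ 4 ^ 4"
  assumes A: "\<And>y. mink y y = 0 \<Longrightarrow> mink (A *v y) (A *v y) = 0"
  shows "\<exists>l. \<forall>x y. mink (A *v x) (A *v y) = l * mink x y"
proof -
  \<comment> \<open>The Gram matrix of the columns; it has to be \<open>G 4 4\<close> times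
    diag(-1,-1,-1,1).\<close>
  define G where "G i j = mink (column i A) (column j A)" for i j
  have G_sym: "G i j = G j i" for i j by (simp add: G_def mink_commute)
  have expand: "mink (A *v x) (A *v y) =
      x$1 * (y$1 * G 1 1 + y$2 * G 1 2 + y$3 * G 1 3 + y$4 * G 1 4)
    + x$2 * (y$1 * G 1 2 + y$2 * G 2 2 + y$3 * G 2 3 + y$4 * G 2 4)
    + x$3 * (y$1 * G 1 3 + y$2 * G 2 3 + y$3 * G 3 3 + y$4 * G 3 4)
    + x$4 * (y$1 * G 1 4 + y$2 * G 2 4 + y$3 * G 3 4 + y$4 * G 4 4)" for x y
    unfolding matrix_vector_mult_columns_4 mink_add_left mink_add_right mink_scale_left mink_scale_right
      G_def[symmetric] G_sym[of 2 1] G_sym[of 3 1] G_sym[of 3 2] G_sym[of 4 1] G_sym[of 4 2] G_sym[of 4 3]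
    by (simp only: distrib_left add_ac mult_ac)
  have null: "a * (a * G 1 1 + b * G 1 2 + c * G 1 3 + d * G 1 4)
    + b * (a * G 1 2 + b * G 2 2 + c * G 2 3 + d * G 2 4)
    + c * (a * G 1 3 + b * G 2 3 + c * G 3 3 + d * G 3 4)
    + d * (a * G 1 4 + b * G 2 4 + c * G 3 4 + d * G 4 4) = 0"
    if "d * d = a * a + b * b + c * c" for a b c d
    using A[of "vec4 a b c d"] that unfolding expand by (simp add: mink_def)
  have half: "x = 0" if "2 * x = 0" for x :: 'a using that two_neq_0 by simp
  have diag: "p = 0" "r = - s" if "r + p + (p + s) = 0" "r - p + (s - p) = 0" for p r s :: 'a
  proof -
    have "2 * (2 * p) = 0" "2 * (r + s) = 0" using that by algebra+
    then show "p = 0" "r = - s" using half by (simp_all only: eq_neg_iff_add_eq_0)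
  qed
  \<comment> \<open>The arguments of \<open>null\<close> are d, a, b, c in this order, so these are
    e4 + e1 and e4 - e1.\<close>
  have "G 1 1 + G 1 4 + (G 1 4 + G 4 4) = 0" "G 1 1 - G 1 4 + (G 4 4 - G 1 4) = 0"
    using null[of 1 1 0 0] null[of 1 "- 1" 0 0] by (simp_all add: algebra_simps)
  note d1 = diag[OF this]
  have "G 2 2 + G 2 4 + (G 2 4 + G 4 4) = 0" "G 2 2 - G 2 4 + (G 4 4 - G 2 4) = 0"
    using null[of 1 0 1 0] null[of 1 0 "- 1" 0] by (simp_all add: algebra_simps)
  note d2 = diag[OF this]
  have "G 3 3 + G 3 4 + (G 3 4 + G 4 4) = 0" "G 3 3 - G 3 4 + (G 4 4 - G 3 4) = 0"
    using null[of 1 0 0 1] null[of 1 0 0 "- 1"] by (simp_all add: algebra_simps)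
  note d3 = diag[OF this]
  obtain a b :: 'a where ab: "a \<noteq> 0" "b \<noteq> 0" "a * a + b * b = - 1"
    using sum_two_squares_minus_1 by blast
  have e: "s * t * (a * b * G 1 2) + s * (a * G 1 3) + t * (b * G 2 3) = 0"
    if st: "s * s = 1" "t * t = 1" for s t
  proof -
    have q: "s * a * (s * a) + t * b * (t * b) = - 1"
    proof -
      have "s * a * (s * a) + t * b * (t * b) = (s * s) * (a * a) + (t * t) * (b * b)"
        by (simp add: mult_ac)
      then show ?thesis by (simp add: st ab(3))
    qed
    have "0 * 0 = s * a * (s * a) + t * b * (t * b) + 1 * 1" by (simp add: q)
    from null[OF this]
    have "2 * (s * t * (a * b * G 1 2) + s * (a * G 1 3) + t * (b * G 2 3))
      - (s * a * (s * a) + t * b * (t * b) + 1) * G 4 4 = 0"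
      by (simp add: d1 d2 d3 algebra_simps)
    then have "2 * (s * t * (a * b * G 1 2) + s * (a * G 1 3) + t * (b * G 2 3)) = 0"
      unfolding q by (simp only: add.left_inverse mult_zero_left diff_zero)
    then show ?thesis by (rule half)
  qed
  \<comment> \<open>Pairwise sums of these three sign choices isolate each product.\<close>
  have "a * b * G 1 2 + a * G 1 3 + b * G 2 3 = 0" "- (a * b * G 1 2) + a * G 1 3 - b * G 2 3 = 0"
    "- (a * b * G 1 2) - a * G 1 3 + b * G 2 3 = 0"
    using e[of 1 1] e[of 1 "- 1"] e[of "- 1" 1] by simp_all
  then have "2 * (a * b * G 1 2) = 0" "2 * (a * G 1 3) = 0" "2 * (b * G 2 3) = 0"
    by algebra+
  then have o: "G 1 2 = 0" "G 1 3 = 0" "G 2 3 = 0" using ab two_neq_0 by simp_all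
  have "mink (A *v x) (A *v y) = G 4 4 * mink x y" for x y
    unfolding expand d1 d2 d3 o by (simp add: mink_def algebra_simps)
  then show ?thesis by blast
qed

section \<open>Coordinate-wise automorphisms and the converse direction\<close>

lemma vmap_nth [simp]: "vmap \<tau> r $ i = \<tau> (r $ i)"
  by (simp add: vmap_def)

lemma field_aut_minus:
  assumes "field_aut \<tau>"
  shows "\<tau> 0 = 0" "\<tau> (- x) = - \<tau> x" "\<tau> (x - y) = \<tau> x - \<tau> y"
proof -
  have add: "\<tau> (x + y) = \<tau> x + \<tau> y" for x y using assms by (simp add: field_aut_def)
  show 0: "\<tau> 0 = 0" using add[of 0 0] by (metis add.right_neutral add_left_cancel)
  show m: "\<tau> (- x) = - \<tau> x" for x using add[of "- x" x] 0 by (simp add: eq_neg_iff_add_eq_0)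
  show "\<tau> (x - y) = \<tau> x - \<tau> y" using add[of x "- y"] m by simp
qed

text \<open>The coefficients of the form are 1 and -1, which \<open>\<tau>\<close> fixes.\<close>

lemma mink_vmap:
  assumes "field_aut \<tau>"
  shows "mink (vmap \<tau> x) (vmap \<tau> y) = \<tau> (mink x y)"
  using assms field_aut_minus[OF assms] by (simp add: mink_def field_aut_def)

lemma vmap_diff:
  assumes "field_aut \<tau>"
  shows "vmap \<tau> (x - y) = vmap \<tau> x - vmap \<tau> y"
  using field_aut_minus[OF assms] by (simp add: vec_eq_iff)

lemma inj_vmap:
  assumes "field_aut \<tau>"
  shows "inj (vmap \<tau>)"
  using assms by (auto simp: field_aut_def bij_def inj_def vec_eq_iff)

text \<open>Covers both matrix types, with \<open>l\<close> equal to 1 or -1. Nondegeneracy of the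
  form makes \<open>M\<close> injective.\<close>

lemma similitude_null_preserving:
  fixes \<psi> :: "'a::field ^ 4 \<Rightarrow> 'a ^ 4"
  assumes M: "\<And>x y. mink (M *v x) (M *v y) = l * mink x y" and l: "l \<noteq> 0" and \<alpha>: "\<alpha> \<noteq> 0"
    and \<tau>: "field_aut \<tau>" and \<psi>: "\<And>r. \<psi> r = \<alpha> *s (M *v vmap \<tau> r) + r0"
  shows "null_preserving \<psi>"
  unfolding null_preserving_def
proof (intro allI impI)
  fix x y :: "'a ^ 4" assume xy: "mink (x - y) (x - y) = 0 \<and> x \<noteq> y"
  let ?v = "vmap \<tau> x - vmap \<tau> y"
  have d: "\<psi> x - \<psi> y = \<alpha> *s (M *v ?v)"
    by (simp add: \<psi> matrix_vector_mult_diff_distrib vector_ssub_ldistrib)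
  have "mink ?v ?v = 0"
    using xy mink_vmap[OF \<tau>, of "x - y" "x - y"] vmap_diff[OF \<tau>, of x y] field_aut_minus(1)[OF \<tau>] by simp
  then have "mink (\<psi> x - \<psi> y) (\<psi> x - \<psi> y) = 0" by (simp add: d mink_scale_left mink_scale_right M)
  moreover have "\<psi> x \<noteq> \<psi> y"
  proof
    assume "\<psi> x = \<psi> y"
    then have Mv: "M *v ?v = 0" using d \<alpha> by simp
    have "mink ?v z = 0" for z using M[of ?v z] l by (simp add: Mv mink_zero_left)
    then have "?v = 0" by (rule mink_nondegenerate)
    then show False using xy inj_vmap[OF \<tau>] by (auto simp: inj_def)
  qed
  ultimately show "mink (\<psi> x - \<psi> y) (\<psi> x - \<psi> y) = 0 \<and> \<psi> x \<noteq> \<psi> y" by blast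
qed

section \<open>From endomorphisms to matrices\<close>

lemma (in finite_field_3_mod_4) null_preserving_semilinear:
  fixes f :: "'a ^ 4 \<Rightarrow> 'a ^ 4"
  assumes np: "null_preserving f" and f0: "f 0 = 0"
  obtains A \<tau> l where "field_aut \<tau>" "l \<noteq> 0" "\<And>x. f x = A *v vmap \<tau> x"
    "\<And>x y. mink (A *v x) (A *v y) = l * mink x y"
proof -
  have "inj f" using np by (rule null_preserving_inj)
  then have "surj f" by (simp add: finite_UNIV_inj_surj)
  define g where "g = inv f"
  have gf: "g (f x) = x" and fg: "f (g x) = x" for x
    using \<open>inj f\<close> \<open>surj f\<close> by (simp_all add: g_def surj_f_inv_f)
  \<comment> \<open>An injective self-map of the finite relation \<open>E\<close> is onto, so the
    inverse of \<open>f\<close> preserves it too.\<close>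
  define E :: "(('a ^ 4) \<times> ('a ^ 4)) set" where "E = {(x, y). mink (x - y) (x - y) = 0}"
  have "map_prod f f ` E \<subseteq> E" using null_preservingD(1)[OF np] by (auto simp: E_def)
  moreover have "inj_on (map_prod f f) E"
    using prod.inj_map[OF \<open>inj f\<close> \<open>inj f\<close>] by (rule inj_on_subset) simp
  ultimately have E: "map_prod f f ` E = E" by (intro endo_inj_surj) auto
  have "null_preserving g"
    unfolding null_preserving_def
  proof (intro allI impI)
    fix x y :: "'a ^ 4" assume xy: "mink (x - y) (x - y) = 0 \<and> x \<noteq> y"
    then have "(x, y) \<in> map_prod f f ` E" unfolding E by (simp add: E_def)
    then obtain u v where "mink (u - v) (u - v) = 0" "x = f u" "y = f v" by (auto simp: E_def)
    with xy gf show "mink (g x - g y) (g x - g y) = 0 \<and> g x \<noteq> g y" by auto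
  qed
  then interpret null_automorphism_0 ty f g
    using np gf fg f0 by unfold_locales
  obtain \<tau> where \<tau>: "field_aut \<tau>" and hom: "\<And>c x. f (c *s x) = \<tau> c *s f x"
    using semilinear by blast
  define A :: "'a ^ 4 ^ 4" where "A = (\<chi> i j. f (axis j 1) $ i)"
  have col: "column j A = f (axis j 1)" for j by (simp add: column_def A_def vec_eq_iff)
  have fA: "f x = A *v vmap \<tau> x" for x
  proof -
    have "x = x$1 *s axis 1 1 + x$2 *s axis 2 1 + x$3 *s axis 3 1 + x$4 *s axis 4 1"
      by (rule vec4_eqI) (simp_all add: axis_def)
    then have "f x = f (x$1 *s axis 1 1 + x$2 *s axis 2 1 + x$3 *s axis 3 1 + x$4 *s axis 4 1)"
      by (rule arg_cong)
    then show ?thesis by (simp add: matrix_vector_mult_columns_4 col additive hom)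
  qed
  have "mink (A *v y) (A *v y) = 0" if y: "mink y y = 0" for y
  proof -
    have bij: "bij \<tau>" using \<tau> by (simp add: field_aut_def)
    \<comment> \<open>A null \<open>y\<close> comes from a null \<open>x\<close> through
      \<open>\<tau>\<close>, so \<open>A *v y\<close> is the image \<open>f x\<close> of a null
      vector.\<close>
    define x where "x = vmap (inv \<tau>) y"
    have yx: "y = vmap \<tau> x"
      using bij by (simp add: x_def vec_eq_iff bij_is_surj surj_f_inv_f)
    have "\<tau> (mink x x) = \<tau> 0"
      using mink_vmap[OF \<tau>, of x x] y field_aut_minus(1)[OF \<tau>] by (simp flip: yx)
    then have "mink x x = 0" using bij by (simp add: bij_def inj_eq)
    then show ?thesis using null_image[of x] by (simp only: fA yx)
  qed
  then obtain l where l: "\<And>x y. mink (A *v x) (A *v y) = l * mink x y"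
    using similitude_if_null_preserved[of A] by blast
  \<comment> \<open>\<open>f\<close> is onto, so a zero multiplier would make the form vanish
    identically.\<close>
  have "l \<noteq> 0"
  proof
    assume "l = 0"
    then have "mink x y = 0" for x y :: "'a ^ 4"
      using l[of "vmap \<tau> (g x)" "vmap \<tau> (g y)"] by (simp flip: fA add: fg)
    from this[of "vec4 1 0 0 0" "vec4 1 0 0 0"] show False by (simp add: mink_def)
  qed
  from that[OF \<tau> this fA l] show ?thesis .
qed

theorem theorem4p9:
  fixes \<psi> :: "'a::{finite,field} ^ 4 \<Rightarrow> 'a ^ 4"
  assumes "CARD('a) mod 4 = 3"
  shows "(\<forall>r1 r2. mink (r1 - r2) (r1 - r2) = 0 \<and> r1 \<noteq> r2 \<longrightarrow>
            mink (\<psi> r1 - \<psi> r2) (\<psi> r1 - \<psi> r2) = 0 \<and> \<psi> r1 \<noteq> \<psi> r2)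
     \<longleftrightarrow>
     (\<exists>\<alpha> r0 \<tau>. \<alpha> \<noteq> 0 \<and> field_aut \<tau> \<and>
        ((\<exists>L. lorentz L \<and> (\<forall>r. \<psi> r = \<alpha> *s (L *v vmap \<tau> r) + r0)) \<or>
         (\<exists>K. anti_lorentz K \<and> (\<forall>r. \<psi> r = \<alpha> *s (K *v vmap \<tau> r) + r0))))"
    (is "_ \<longleftrightarrow> ?R")
  unfolding null_preserving_def[symmetric]
proof
  interpret finite_field_3_mod_4 "TYPE('a)"
    by unfold_locales (rule assms)
  assume np: "null_preserving \<psi>"
  define f where "f x = \<psi> x - \<psi> 0" for x
  have "null_preserving f" using np by (simp add: null_preserving_def f_def)
  moreover have "f 0 = 0" by (simp add: f_def)
  ultimately obtain A \<tau> l where \<tau>: "field_aut \<tau>" and l: "l \<noteq> 0"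
    and fA: "\<And>x. f x = A *v vmap \<tau> x"
    and A: "\<And>x y. mink (A *v x) (A *v y) = l * mink x y"
    by (rule null_preserving_semilinear) (rule that)
  \<comment> \<open>Dividing \<open>A\<close> by \<open>\<alpha>\<close> turns the multiplier
    \<open>l\<close> into 1 or -1.\<close>
  obtain \<alpha> where \<alpha>: "l = \<alpha> * \<alpha> \<or> l = - (\<alpha> * \<alpha>)" using square_or_minus_square by blast
  with l have "\<alpha> \<noteq> 0" by auto
  define L :: "'a ^ 4 ^ 4" where "L = (\<chi> i j. inverse \<alpha> * A $ i $ j)"
  have L: "L *v x = inverse \<alpha> *s (A *v x)" for x
    by (simp add: vec_eq_iff matrix_vector_mult_def L_def sum_distrib_left mult.assoc)
  have "\<alpha> *s (L *v vmap \<tau> r) = f r" for r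
    using \<open>\<alpha> \<noteq> 0\<close> by (simp add: L fA vector_smult_assoc)
  then have \<psi>: "\<forall>r. \<psi> r = \<alpha> *s (L *v vmap \<tau> r) + \<psi> 0"
    by (simp add: f_def)
  have "mink (L *v x) (L *v y) = l / (\<alpha> * \<alpha>) * mink x y" for x y
    by (simp add: L A mink_scale_left mink_scale_right divide_inverse mult_ac)
  then have "lorentz L \<or> anti_lorentz L"
    using \<alpha> \<open>\<alpha> \<noteq> 0\<close> by (auto simp: lorentz_def anti_lorentz_def)
  then show ?R
  proof
    assume "lorentz L"
    with \<psi> \<open>\<alpha> \<noteq> 0\<close> \<tau> show ?R by (intro exI conjI disjI1)
  next
    assume "anti_lorentz L"
    with \<psi> \<open>\<alpha> \<noteq> 0\<close> \<tau> show ?R by (intro exI conjI disjI2)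
  qed
next
  assume ?R
  then obtain \<alpha> r0 \<tau> M where "\<alpha> \<noteq> 0" "field_aut \<tau>" and M: "lorentz M \<or> anti_lorentz M"
    and \<psi>: "\<forall>r. \<psi> r = \<alpha> *s (M *v vmap \<tau> r) + r0"
    by (elim exE conjE disjE) (rule that; (assumption | rule disjI1, assumption | rule disjI2, assumption))+
  from M obtain l where l: "l \<noteq> 0" and M': "\<And>x y. mink (M *v x) (M *v y) = l * mink x y"
  proof
    assume "lorentz M"
    then show ?thesis using that[of 1] by (simp add: lorentz_def)
  next
    assume "anti_lorentz M"
    then show ?thesis using that[of "- 1"] by (simp add: anti_lorentz_def)
  qed
  show "null_preserving \<psi>"
    using similitude_null_preserving[OF M' l \<open>\<alpha> \<noteq> 0\<close> \<open>field_aut \<tau>\<close>] \<psi> by blast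
qed

end
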